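(* Let $R$ be a commutative ring and let $M$ be a faithful $R$-module with $rad_M(0)=(0)$. Then the following statements are equivalent: (a) $\chi(AG(M)^* )$ is finite; (b) $cl(AG(M)^* )$ is finite; (c) $AG(M)^*$ does not have an infinite clique; (d) $R$ has a finite number of minimal prime ideals.
   Context: $R$ is a commutative ring with nonzero identity and $M$ is a unital $R$-module. For $N\le M$ (submodule), $(N:M)=\{r\in R\mid rM\subseteq N\}$, and $Ann(M)=((0):M)$; $M$ is faithful if $Ann(M)=(0)$. A prime submodule of $M$ is a submodule $P\neq M$ such that whenever $re\in P$ with $r\in R$, $e\in M$, then $r\in(P:M)$ or $e\in P$. The prime radical $rad_M(N)$ is the intersection of all prime submodules of $M$ containing $N$, and is $M$ if $N$ is not contained in any prime submodule. The product of $N,K\le M$ is $NK=(N:M)(K:M)M$. $AG(M)^*$ is the undirected graph whose vertices are the proper submodules $N$ of $M$ with $(N:M)\neq Ann(M)$ for which there exists a proper submodule $K$ of $M$ (possibly $K=N$) with $(K:M)\neq Ann(M)$ and $NK=(0)$; two distinct vertices $N,K$ are adjacent if and only if $NK=(0)$. $\chi(G)$ is the chromatic number of a graph $G$ and $cl(G)$ its clique number (the number of vertices in a largest clique, a clique being a maximal complete subgraph). *)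

theory Defs
  imports
    "HOL-Algebra.Module"
    "HOL-Algebra.Ideal_Product"
    "HOL-Library.Extended_Nat"
begin

section \<open>Undirected graphs\<close>

record 'v ugraph =
  ug_verts :: "'v set"
  ug_edges :: "'v set set"

definition proper_colouring :: "'v ugraph \<Rightarrow> nat \<Rightarrow> ('v \<Rightarrow> nat) \<Rightarrow> bool" where
  "proper_colouring G k f \<longleftrightarrow>
     f ` ug_verts G \<subseteq> {..<k} \<and>
     (\<forall>u\<in>ug_verts G. \<forall>v\<in>ug_verts G. {u, v} \<in> ug_edges G \<longrightarrow> f u \<noteq> f v)"

text \<open>The infimum is \<^term>\<open>\<infinity>\<close> when no colouring with finitely many colours exists.\<close>

definition chromatic_number :: "'v ugraph \<Rightarrow> enat" where
  "chromatic_number G = (INF k\<in>{k. \<exists>f. proper_colouring G k f}. enat k)"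

text \<open>Complete subgraphs are identified with their vertex sets. A clique is a complete
  subgraph that is maximal with respect to inclusion.\<close>

definition complete_subgraph :: "'v ugraph \<Rightarrow> 'v set \<Rightarrow> bool" where
  "complete_subgraph G C \<longleftrightarrow>
     C \<subseteq> ug_verts G \<and> (\<forall>u\<in>C. \<forall>v\<in>C. u \<noteq> v \<longrightarrow> {u, v} \<in> ug_edges G)"

definition clique :: "'v ugraph \<Rightarrow> 'v set \<Rightarrow> bool" where
  "clique G C \<longleftrightarrow>
     complete_subgraph G C \<and> (\<forall>D. complete_subgraph G D \<and> C \<subseteq> D \<longrightarrow> D = C)"

text \<open>The supremum covers the case in which there are cliques of unbounded finite size but
  no largest one; the value is then \<^term>\<open>\<infinity>\<close>.\<close>

definition clique_number :: "'v ugraph \<Rightarrow> enat" where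
  "clique_number G =
     (SUP C\<in>{C. clique G C}. if finite C then enat (card C) else \<infinity>)"


section \<open>Submodules\<close>

definition proper_submodule ::
  "('a, 'c) ring_scheme \<Rightarrow> ('a, 'b, 'd) module_scheme \<Rightarrow> 'b set \<Rightarrow> bool" where
  "proper_submodule R M N \<longleftrightarrow> submodule N R M \<and> N \<noteq> carrier M"

text \<open>The ideal $(N : M)$.\<close>

definition residual ::
  "('a, 'c) ring_scheme \<Rightarrow> ('a, 'b, 'd) module_scheme \<Rightarrow> 'b set \<Rightarrow> 'a set" where
  "residual R M N = {r \<in> carrier R. \<forall>x\<in>carrier M. r \<odot>\<^bsub>M\<^esub> x \<in> N}"

definition annihilator ::
  "('a, 'c) ring_scheme \<Rightarrow> ('a, 'b, 'd) module_scheme \<Rightarrow> 'a set" where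
  "annihilator R M = residual R M {\<zero>\<^bsub>M\<^esub>}"

definition faithful_module ::
  "('a, 'c) ring_scheme \<Rightarrow> ('a, 'b, 'd) module_scheme \<Rightarrow> bool" where
  "faithful_module R M \<longleftrightarrow> annihilator R M = {\<zero>\<^bsub>R\<^esub>}"

definition prime_submodule ::
  "('a, 'c) ring_scheme \<Rightarrow> ('a, 'b, 'd) module_scheme \<Rightarrow> 'b set \<Rightarrow> bool" where
  "prime_submodule R M P \<longleftrightarrow>
     proper_submodule R M P \<and>
     (\<forall>r\<in>carrier R. \<forall>e\<in>carrier M. r \<odot>\<^bsub>M\<^esub> e \<in> P \<longrightarrow> r \<in> residual R M P \<or> e \<in> P)"

definition prime_radical ::
  "('a, 'c) ring_scheme \<Rightarrow> ('a, 'b, 'd) module_scheme \<Rightarrow> 'b set \<Rightarrow> 'b set" where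
  "prime_radical R M N =
     (if \<exists>P. prime_submodule R M P \<and> N \<subseteq> P
      then \<Inter>{P. prime_submodule R M P \<and> N \<subseteq> P}
      else carrier M)"

text \<open>The submodule $I M$ of finite sums of elements $a x$ with $a \in I$ and $x \in M$, for an
  ideal $I$ (closure under negation and the zero element come from $I$).\<close>

inductive_set ideal_smult ::
  "('a, 'b, 'd) module_scheme \<Rightarrow> 'a set \<Rightarrow> 'b set" for M and I where
  smult: "\<lbrakk> a \<in> I; x \<in> carrier M \<rbrakk> \<Longrightarrow> a \<odot>\<^bsub>M\<^esub> x \<in> ideal_smult M I"
| add: "\<lbrakk> x \<in> ideal_smult M I; y \<in> ideal_smult M I \<rbrakk> \<Longrightarrow> x \<oplus>\<^bsub>M\<^esub> y \<in> ideal_smult M I"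

definition submodule_prod ::
  "('a, 'c) ring_scheme \<Rightarrow> ('a, 'b, 'd) module_scheme \<Rightarrow> 'b set \<Rightarrow> 'b set \<Rightarrow> 'b set" where
  "submodule_prod R M N K = ideal_smult M (ideal_prod R (residual R M N) (residual R M K))"


section \<open>The graph $AG(M)^*$\<close>

definition AG_star_verts ::
  "('a, 'c) ring_scheme \<Rightarrow> ('a, 'b, 'd) module_scheme \<Rightarrow> 'b set set" where
  "AG_star_verts R M =
     {N. proper_submodule R M N \<and> residual R M N \<noteq> annihilator R M \<and>
         (\<exists>K. proper_submodule R M K \<and> residual R M K \<noteq> annihilator R M \<and>
              submodule_prod R M N K = {\<zero>\<^bsub>M\<^esub>})}"

definition AG_star ::
  "('a, 'c) ring_scheme \<Rightarrow> ('a, 'b, 'd) module_scheme \<Rightarrow> 'b set ugraph" where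
  "AG_star R M =
     \<lparr> ug_verts = AG_star_verts R M,
       ug_edges = {{N, K} | N K. N \<in> AG_star_verts R M \<and> K \<in> AG_star_verts R M \<and> N \<noteq> K \<and>
                                 submodule_prod R M N K = {\<zero>\<^bsub>M\<^esub>}} \<rparr>"


section \<open>Minimal prime ideals\<close>

definition minimal_prime_ideal :: "('a, 'c) ring_scheme \<Rightarrow> 'a set \<Rightarrow> bool" where
  "minimal_prime_ideal R P \<longleftrightarrow>
     primeideal P R \<and> (\<forall>Q. primeideal Q R \<and> Q \<subseteq> P \<longrightarrow> Q = P)"

end

theory Submission
  imports Defs
begin

text \<open>
  Since \<open>M\<close> is faithful, \<open>N K = 0\<close> means \<open>(N : M) (K : M) = 0\<close>, and \<open>rad(0) = 0\<close> makes \<open>R\<close>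
  reduced. If \<open>R\<close> has finitely many minimal primes, a vertex \<open>N\<close> is coloured by a minimal prime
  that does not contain \<open>(N : M)\<close>; a colouring bounds the size of every clique. Conversely, the
  minimal primes of a reduced ring form a Hausdorff space under the topology generated by the
  sets \<open>D(a)\<close> of the minimal primes not containing \<open>a\<close>. If it is infinite, it contains a sequence
  of pairwise disjoint nonempty sets \<open>D(x\<^sub>n)\<close>; then the \<open>x\<^sub>n\<close> are nonzero and pairwise orthogonal,
  and the submodules \<open>x\<^sub>n M\<close> form an infinite complete subgraph.
\<close>

section \<open>Colourings and cliques\<close>

lemma chromatic_number_finite_iff:
  "chromatic_number G \<noteq> \<infinity> \<longleftrightarrow> (\<exists>k f. proper_colouring G k f)"
proof
  assume "chromatic_number G \<noteq> \<infinity>"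
  then show "\<exists>k f. proper_colouring G k f"
    unfolding chromatic_number_def by (auto simp: top_enat_def[symmetric])
next
  assume "\<exists>k f. proper_colouring G k f"
  then obtain k f where "proper_colouring G k f" by blast
  then have "chromatic_number G \<le> enat k"
    unfolding chromatic_number_def by (intro INF_lower) blast
  then show "chromatic_number G \<noteq> \<infinity>" by (auto dest: enat_ile)
qed

text \<open>Pairwise adjacent vertices receive distinct colours, so \<open>f\<close> is injective on
  \<open>C\<close>. The bound \<open>k\<close> does not depend on \<open>C\<close>, and so it also
  bounds the supremum \<open>clique_number\<close>.\<close>

lemma proper_colouring_complete_subgraph:
  assumes "proper_colouring G k f" and "complete_subgraph G C"
  shows "finite C \<and> card C \<le> k"
proof -
  have "inj_on f C" and "f ` C \<subseteq> {..<k}"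
    using assms unfolding inj_on_def proper_colouring_def complete_subgraph_def by blast+
  then show ?thesis
    using inj_on_finite[of f C "{..<k}"] card_inj_on_le[of f C "{..<k}"] by auto
qed

lemma clique_number_finite:
  assumes "proper_colouring G k f"
  shows "clique_number G \<noteq> \<infinity>"
proof -
  have "clique_number G \<le> enat k"
    unfolding clique_number_def
    using proper_colouring_complete_subgraph[OF assms]
    by (intro SUP_least) (auto simp: clique_def)
  then show ?thesis by (auto dest: enat_ile)
qed

lemma clique_number_infinite:
  assumes "clique G C" and "infinite C"
  shows "clique_number G = \<infinity>"
proof -
  have "(if finite C then enat (card C) else \<infinity>) \<le> clique_number G"
    unfolding clique_number_def using assms(1) by (intro SUP_upper) simp
  then show ?thesis using assms(2) by simp
qed

text \<open>Zorn's lemma applies because two vertices in the union of a chain already lie in a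
  common member. A \<open>clique\<close> is maximal by definition, whereas the later construction
  yields only a complete subgraph; this closes the gap.\<close>

lemma complete_subgraph_extends_to_clique:
  assumes "complete_subgraph G C"
  obtains D where "clique G D" and "C \<subseteq> D"
proof -
  let ?A = "{D. complete_subgraph G D \<and> C \<subseteq> D}"
  have "\<exists>D\<in>?A. \<forall>X\<in>?A. D \<subseteq> X \<longrightarrow> X = D"
  proof (rule subset_Zorn_nonempty)
    show "?A \<noteq> {}" using assms by blast
    fix \<C> assume ne: "\<C> \<noteq> {}" and ch: "subset.chain ?A \<C>"
    have sub: "\<C> \<subseteq> ?A" and tot: "\<And>X Y. \<lbrakk>X \<in> \<C>; Y \<in> \<C>\<rbrakk> \<Longrightarrow> X \<subseteq> Y \<or> Y \<subseteq> X"
      using ch unfolding subset_chain_def by blast+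
    have "{u, v} \<in> ug_edges G" if uv: "u \<in> \<Union>\<C>" "v \<in> \<Union>\<C>" "u \<noteq> v" for u v
    proof -
      obtain X where "X \<in> \<C>" "u \<in> X" "v \<in> X" using uv tot by blast
      then show ?thesis using sub uv(3) unfolding complete_subgraph_def by blast
    qed
    moreover have "\<Union>\<C> \<subseteq> ug_verts G"
      using sub unfolding complete_subgraph_def by blast
    ultimately have "complete_subgraph G (\<Union>\<C>)"
      unfolding complete_subgraph_def by (intro conjI ballI impI)
    then show "\<Union>\<C> \<in> ?A" using ne sub by blast
  qed
  then obtain D where D_in: "D \<in> ?A" and D_max: "\<forall>X\<in>?A. D \<subseteq> X \<longrightarrow> X = D"
    by (rule bexE)
  have "X = D" if "complete_subgraph G X" "D \<subseteq> X" for X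
    using D_max D_in that by (simp add: subset_trans[of C D X])
  with D_in have "clique G D" unfolding clique_def by simp
  then show thesis using D_in by (intro that[of D]) simp_all
qed

section \<open>Minimal primes of a reduced ring\<close>

text \<open>Excluding square-zero elements excludes all nilpotents: \<open>pow_mult_eq_zero\<close>
  with \<open>t = \<one>\<close> passes from squares to arbitrary powers.\<close>

locale reduced_cring = cring R for R (structure) +
  assumes reduced: "\<lbrakk>a \<in> carrier R; a \<otimes> a = \<zero>\<rbrakk> \<Longrightarrow> a = \<zero>"
begin

section \<open>Minimal primes as complements of maximal multiplicative sets\<close>

text \<open>Induction on \<open>n\<close> with \<open>t\<close> arbitrary: one factor
  \<open>a\<close> moves into \<open>t\<close>, which leaves
  \<open>a \<otimes> (a \<otimes> t) = \<zero>\<close>. Then \<open>a \<otimes> t\<close> has square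
  zero and vanishes by reducedness.\<close>

lemma pow_mult_eq_zero:
  assumes "a \<in> carrier R" "t \<in> carrier R" "a [^] (n::nat) \<otimes> t = \<zero>"
  shows "a \<otimes> t = \<zero>"
  using assms(2,3)
proof (induction n arbitrary: t)
  case 0
  then show ?case using assms(1) by simp
next
  case (Suc n)
  have "a [^] n \<otimes> (a \<otimes> t) = \<zero>"
    using Suc.prems assms(1) by (simp add: m_assoc)
  then have "a \<otimes> (a \<otimes> t) = \<zero>"
    using Suc assms(1) by simp
  moreover have "(a \<otimes> t) \<otimes> (a \<otimes> t) = t \<otimes> (a \<otimes> (a \<otimes> t))"
    using Suc.prems assms(1) by (simp add: m_ac)
  ultimately have "(a \<otimes> t) \<otimes> (a \<otimes> t) = \<zero>"
    using Suc.prems by simp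
  then show ?case using reduced[of "a \<otimes> t"] Suc.prems assms(1) by simp
qed

text \<open>The complement of a maximal multiplicative set avoiding \<open>0\<close> consists of the elements killed
  by some member of that set, which makes it visibly an ideal.\<close>

lemma maximal_submonoid_complement:
  assumes T: "submonoid T R" "\<zero> \<notin> T"
    and max: "\<And>T'. \<lbrakk>submonoid T' R; \<zero> \<notin> T'; T \<subseteq> T'\<rbrakk> \<Longrightarrow> T' = T"
  shows "carrier R - T = {a \<in> carrier R. \<exists>t\<in>T. a \<otimes> t = \<zero>}"
    and "minimal_prime_ideal R (carrier R - T)"
proof -
  interpret T: submonoid T R by fact
  have Tc: "t \<in> carrier R" if "t \<in> T" for t using that T.subset by blast
  have killed: "\<exists>t\<in>T. a \<otimes> t = \<zero>" if a: "a \<in> carrier R" "a \<notin> T" for a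
  proof (rule ccontr)
    assume no: "\<not> (\<exists>t\<in>T. a \<otimes> t = \<zero>)"
    \<comment> \<open>\<open>S\<close> is the multiplicative set generated by \<open>T\<close> and
      \<open>a\<close>. If no member of \<open>T\<close> kills \<open>a\<close>, then
      \<open>S\<close> avoids \<open>\<zero>\<close>, and maximality forces \<open>S = T\<close>,
      contrary to \<open>a \<notin> T\<close>.\<close>
    define S where "S = {a [^] (n::nat) \<otimes> t | n t. t \<in> T}"
    have "submonoid S R"
    proof
      show "S \<subseteq> carrier R" using a Tc by (auto simp: S_def)
      have "a [^] (0::nat) \<otimes> \<one> \<in> S" unfolding S_def using T.one_closed by blast
      then show "\<one> \<in> S" by simp
      fix x y assume "x \<in> S" "y \<in> S"
      then obtain m n s t where st: "s \<in> T" "t \<in> T"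
        and xy: "x = a [^] (m::nat) \<otimes> s" "y = a [^] (n::nat) \<otimes> t"
        unfolding S_def by blast
      have "x \<otimes> y = a [^] m \<otimes> a [^] n \<otimes> (s \<otimes> t)"
        using a Tc st by (simp add: xy m_ac)
      then have "x \<otimes> y = a [^] (m + n) \<otimes> (s \<otimes> t)"
        using a by (simp add: nat_pow_mult)
      then show "x \<otimes> y \<in> S" unfolding S_def using st T.m_closed by blast
    qed
    moreover have "\<zero> \<notin> S"
    proof
      assume "\<zero> \<in> S"
      then obtain n t where "t \<in> T" "a [^] (n::nat) \<otimes> t = \<zero>"
        unfolding S_def by force
      then show False using pow_mult_eq_zero[of a t n] a Tc no by blast
    qed
    moreover have "T \<subseteq> S"
    proof
      fix t assume "t \<in> T"
      then have "a [^] (0::nat) \<otimes> t \<in> S" unfolding S_def by blast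
      then show "t \<in> S" using Tc[OF \<open>t \<in> T\<close>] by simp
    qed
    ultimately have "S = T" using max by blast
    moreover have "a [^] (1::nat) \<otimes> \<one> \<in> S" unfolding S_def using T.one_closed by blast
    ultimately show False using a by simp
  qed
  have not_killed: "a \<otimes> t \<noteq> \<zero>" if "a \<in> T" "t \<in> T" for a t
    using that T.m_closed T(2) by metis
  show eq: "carrier R - T = {a \<in> carrier R. \<exists>t\<in>T. a \<otimes> t = \<zero>}"
    using killed not_killed by blast
  have prime: "primeideal (carrier R - T) R"
  proof (rule primeidealI2)
    show "additive_subgroup (carrier R - T) R"
    proof (rule additive_subgroupI, rule add.subgroupI)
      show "carrier R - T \<subseteq> carrier R" by blast
      show "carrier R - T \<noteq> {}" using T(2) by blast
    next
      fix a assume "a \<in> carrier R - T"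
      then show "\<ominus> a \<in> carrier R - T"
        unfolding eq using Tc by (auto simp: l_minus intro!: bexI)
    next
      fix a b assume "a \<in> carrier R - T" "b \<in> carrier R - T"
      then obtain s t where st: "s \<in> T" "t \<in> T" and ab: "a \<in> carrier R" "b \<in> carrier R"
        and z: "a \<otimes> s = \<zero>" "b \<otimes> t = \<zero>"
        unfolding eq by blast
      have "(a \<oplus> b) \<otimes> (s \<otimes> t) = a \<otimes> (s \<otimes> t) \<oplus> b \<otimes> (s \<otimes> t)"
        using ab Tc st by (simp add: l_distr)
      also have "a \<otimes> (s \<otimes> t) = (a \<otimes> s) \<otimes> t"
        using ab Tc st by (simp add: m_assoc)
      also have "b \<otimes> (s \<otimes> t) = (b \<otimes> t) \<otimes> s"
        using ab Tc st by (simp add: m_ac)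
      also have "(a \<otimes> s) \<otimes> t \<oplus> (b \<otimes> t) \<otimes> s = \<zero>" using z Tc st by simp
      finally show "a \<oplus> b \<in> carrier R - T"
        unfolding eq using ab st T.m_closed by blast
    qed
    show "cring R" by (rule is_cring)
    show "carrier R \<noteq> carrier R - T" using T.one_closed Tc by blast
  next
    fix a x assume "a \<in> carrier R - T" and x: "x \<in> carrier R"
    then obtain t where t: "t \<in> T" "a \<in> carrier R" "a \<otimes> t = \<zero>" unfolding eq by blast
    have "x \<otimes> a \<otimes> t = \<zero>" using t x Tc by (simp add: m_assoc)
    then show "x \<otimes> a \<in> carrier R - T" unfolding eq using t x by blast
    then show "a \<otimes> x \<in> carrier R - T" using t x by (simp add: m_comm)
  next
    fix a b assume "a \<in> carrier R" "b \<in> carrier R" "a \<otimes> b \<in> carrier R - T"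
    then show "a \<in> carrier R - T \<or> b \<in> carrier R - T" using T.m_closed by blast
  qed
  \<comment> \<open>Minimality: each \<open>b\<close> in the complement is killed by some
    \<open>t \<in> T\<close>. A prime \<open>Q\<close> inside the complement contains
    \<open>b \<otimes> t = \<zero>\<close> but not \<open>t\<close>, hence contains
    \<open>b\<close>.\<close>
  have "Q = carrier R - T" if Q: "primeideal Q R" "Q \<subseteq> carrier R - T" for Q
  proof -
    interpret Q: primeideal Q R by (rule Q(1))
    have "b \<in> Q" if b: "b \<in> carrier R - T" for b
    proof -
      obtain t where t: "t \<in> T" "b \<in> carrier R" "b \<otimes> t = \<zero>" using b unfolding eq by blast
      then have "b \<in> Q \<or> t \<in> Q" using Q.I_prime[of b t] Tc by simp
      then show ?thesis using Q(2) t(1) by blast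
    qed
    then show ?thesis using Q(2) by blast
  qed
  then show "minimal_prime_ideal R (carrier R - T)"
    unfolding minimal_prime_ideal_def using prime by blast
qed

text \<open>Zorn's lemma enlarges \<open>S\<close> to a maximal multiplicative set avoiding
  \<open>\<zero>\<close>, and \<open>P\<close> is its complement. The last conclusion records the
  annihilating elements, so that they can be transferred to every minimal prime.\<close>

lemma minimal_prime_avoiding_submonoid:
  assumes S: "submonoid S R" "\<zero> \<notin> S"
  obtains P where "minimal_prime_ideal R P" and "P \<inter> S = {}"
    and "\<And>b. b \<in> P \<Longrightarrow> \<exists>c\<in>carrier R. c \<notin> P \<and> b \<otimes> c = \<zero>"
proof -
  let ?A = "{T. submonoid T R \<and> \<zero> \<notin> T \<and> S \<subseteq> T}"
  have "\<exists>T\<in>?A. \<forall>X\<in>?A. T \<subseteq> X \<longrightarrow> X = T"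
  proof (rule subset_Zorn_nonempty)
    show "?A \<noteq> {}" using S by blast
    fix \<C> assume ne: "\<C> \<noteq> {}" and ch: "subset.chain ?A \<C>"
    have sub: "\<C> \<subseteq> ?A" and tot: "\<And>X Y. \<lbrakk>X \<in> \<C>; Y \<in> \<C>\<rbrakk> \<Longrightarrow> X \<subseteq> Y \<or> Y \<subseteq> X"
      using ch unfolding subset_chain_def by blast+
    have "submonoid (\<Union>\<C>) R"
    proof
      show "\<Union>\<C> \<subseteq> carrier R" using sub submonoid.subset by blast
      show "\<one> \<in> \<Union>\<C>" using ne sub submonoid.one_closed by blast
      fix x y assume "x \<in> \<Union>\<C>" "y \<in> \<Union>\<C>"
      then obtain X where X: "X \<in> \<C>" "x \<in> X" "y \<in> X" using tot by blast
      then have "submonoid X R" using sub by blast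
      then have "x \<otimes> y \<in> X" using X(2,3) by (rule submonoid.m_closed)
      then show "x \<otimes> y \<in> \<Union>\<C>" using X(1) by blast
    qed
    then show "\<Union>\<C> \<in> ?A" using ne sub by blast
  qed
  then obtain T where T_in: "T \<in> ?A" and T_max: "\<forall>X\<in>?A. T \<subseteq> X \<longrightarrow> X = T"
    by (rule bexE)
  have T: "submonoid T R" "\<zero> \<notin> T" "S \<subseteq> T"
    using T_in by simp_all
  have max: "T' = T" if "submonoid T' R" "\<zero> \<notin> T'" "T \<subseteq> T'" for T'
    using T_max that T(3) by simp
  have compl: "carrier R - T = {a \<in> carrier R. \<exists>t\<in>T. a \<otimes> t = \<zero>}"
    "minimal_prime_ideal R (carrier R - T)"
    using maximal_submonoid_complement[OF T(1,2)] max by blast+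
  have "\<exists>c\<in>carrier R. c \<notin> carrier R - T \<and> b \<otimes> c = \<zero>" if "b \<in> carrier R - T" for b
  proof -
    from that obtain c where "c \<in> T" "b \<otimes> c = \<zero>" unfolding compl(1) by blast
    then show ?thesis using submonoid.subset[OF T(1)] by blast
  qed
  then show thesis
    using that[of "carrier R - T"] compl(2) T(3) by blast
qed

text \<open>The complement of \<open>P\<close> is multiplicative and so yields a minimal prime
  \<open>Q\<close> inside \<open>P\<close>; minimality of \<open>P\<close> gives
  \<open>Q = P\<close>. The annihilating elements known for \<open>Q\<close> thus serve for
  \<open>P\<close>.\<close>

lemma minimal_prime_killed:
  assumes P: "minimal_prime_ideal R P" and b: "b \<in> P"
  obtains c where "c \<in> carrier R" "c \<notin> P" "b \<otimes> c = \<zero>"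
proof -
  interpret P: primeideal P R using P unfolding minimal_prime_ideal_def by blast
  have "submonoid (carrier R - P) R"
    by standard (use P.I_prime P.one_imp_carrier P.I_notcarr in auto)
  then obtain Q where Q: "minimal_prime_ideal R Q" "Q \<inter> (carrier R - P) = {}"
    and *: "\<And>b. b \<in> Q \<Longrightarrow> \<exists>c\<in>carrier R. c \<notin> Q \<and> b \<otimes> c = \<zero>"
    using minimal_prime_avoiding_submonoid[of "carrier R - P"] by (auto simp: P.zero_closed)
  have "primeideal Q R" using Q(1) unfolding minimal_prime_ideal_def by blast
  moreover have "Q \<subseteq> carrier R"
    using \<open>primeideal Q R\<close> by (meson additive_subgroup.a_subset ideal.axioms(1) primeideal.axioms(1))
  ultimately have "Q = P"
    using P Q(2) unfolding minimal_prime_ideal_def by blast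
  then show thesis using that * b by blast
qed

text \<open>In a reduced ring the powers of a nonzero \<open>a\<close> form a multiplicative set
  avoiding \<open>\<zero>\<close>. A minimal prime disjoint from that set omits
  \<open>a\<close>.\<close>

lemma minimal_prime_not_containing:
  assumes "a \<in> carrier R" "a \<noteq> \<zero>"
  obtains P where "minimal_prime_ideal R P" "a \<notin> P"
proof -
  let ?S = "range (\<lambda>n::nat. a [^] n)"
  have "submonoid ?S R"
  proof
    show "?S \<subseteq> carrier R" using assms(1) by auto
    show "\<one> \<in> ?S" by (rule range_eqI[of _ _ 0]) simp
    show "x \<otimes> y \<in> ?S" if "x \<in> ?S" "y \<in> ?S" for x y
      using that assms(1) by (auto simp: nat_pow_mult)
  qed
  moreover have "\<zero> \<notin> ?S"
  proof
    assume "\<zero> \<in> ?S"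
    then obtain n where "a [^] (n::nat) = \<zero>" by force
    then show False using pow_mult_eq_zero[of a \<one> n] assms by simp
  qed
  ultimately obtain P where "minimal_prime_ideal R P" "P \<inter> ?S = {}"
    using minimal_prime_avoiding_submonoid by metis
  moreover have "a \<in> ?S" using assms(1) by (intro range_eqI[of _ _ 1]) simp
  ultimately show thesis using that by blast
qed

section \<open>The topology on the set of minimal primes\<close>

text \<open>This is the Zariski basic open set D(a), restricted to the minimal primes.\<close>

definition basic_open :: "'a \<Rightarrow> 'a set set" where
  "basic_open a = {P. minimal_prime_ideal R P \<and> a \<notin> P}"

text \<open>Openness is stated pointwise, with the sets \<open>basic_open a\<close> as a basis.
  Requiring members to be minimal primes keeps \<open>Y\<close> inside the space.\<close>

definition min_open :: "'a set set \<Rightarrow> bool" where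
  "min_open Y \<longleftrightarrow> (\<forall>P\<in>Y. minimal_prime_ideal R P \<and>
     (\<exists>a\<in>carrier R. a \<notin> P \<and> basic_open a \<subseteq> Y))"

lemma basic_open_mult:
  assumes "a \<in> carrier R" "b \<in> carrier R"
  shows "basic_open (a \<otimes> b) = basic_open a \<inter> basic_open b"
proof -
  have "a \<otimes> b \<in> P \<longleftrightarrow> a \<in> P \<or> b \<in> P" if "minimal_prime_ideal R P" for P
  proof -
    interpret P: primeideal P R using that unfolding minimal_prime_ideal_def by blast
    show ?thesis
      using P.I_prime[OF assms] P.I_l_closed[OF _ assms(1), of b] P.I_r_closed[OF _ assms(2), of a]
      by metis
  qed
  then show ?thesis unfolding basic_open_def by blast
qed

text \<open>The minimal primes of a reduced ring intersect in zero. Together with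
  \<open>basic_open_mult\<close>, disjointness of basic open sets thereby becomes orthogonality of
  ring elements.\<close>

lemma basic_open_empty_iff:
  assumes "a \<in> carrier R"
  shows "basic_open a = {} \<longleftrightarrow> a = \<zero>"
proof
  show "a = \<zero>" if "basic_open a = {}"
    using that minimal_prime_not_containing[OF assms] unfolding basic_open_def by blast
next
  have "\<zero> \<in> P" if "minimal_prime_ideal R P" for P
  proof -
    interpret P: primeideal P R using that unfolding minimal_prime_ideal_def by blast
    show ?thesis by (rule P.zero_closed)
  qed
  then show "basic_open a = {}" if "a = \<zero>"
    using that unfolding basic_open_def by blast
qed

lemma min_open_Int_basic_open:
  assumes "min_open Y" "b \<in> carrier R"
  shows "min_open (Y \<inter> basic_open b)"
  unfolding min_open_def
proof (intro ballI conjI)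
  fix P assume P: "P \<in> Y \<inter> basic_open b"
  then show "minimal_prime_ideal R P" using assms(1) unfolding min_open_def by blast
  obtain a where a: "a \<in> carrier R" "a \<notin> P" "basic_open a \<subseteq> Y"
    using P assms(1) unfolding min_open_def by blast
  have "basic_open (a \<otimes> b) = basic_open a \<inter> basic_open b"
    using a assms by (simp add: basic_open_mult)
  moreover have "P \<in> basic_open a \<inter> basic_open b"
    using P a assms(1) unfolding min_open_def basic_open_def by blast
  ultimately have "a \<otimes> b \<notin> P" "basic_open (a \<otimes> b) \<subseteq> Y \<inter> basic_open b"
    using a(3) unfolding basic_open_def by blast+
  then show "\<exists>a\<in>carrier R. a \<notin> P \<and> basic_open a \<subseteq> Y \<inter> basic_open b"
    using a assms by blast
qed

text \<open>Basic open sets are also closed. A point \<open>P\<close> of the difference contains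
  \<open>b\<close>, so some \<open>c\<close> outside \<open>P\<close> kills \<open>b\<close>; then
  \<open>basic_open c\<close> is a neighbourhood of \<open>P\<close> that misses
  \<open>basic_open b\<close>.\<close>

lemma min_open_Diff_basic_open:
  assumes Y: "min_open Y" and b: "b \<in> carrier R"
  shows "min_open (Y - basic_open b)"
proof -
  have "minimal_prime_ideal R P \<and> (\<exists>a\<in>carrier R. a \<notin> P \<and> basic_open a \<subseteq> Y - basic_open b)"
    if P: "P \<in> Y - basic_open b" for P
  proof -
    have mp: "minimal_prime_ideal R P" using P Y unfolding min_open_def by blast
    moreover have "b \<in> P" using P mp unfolding basic_open_def by blast
    ultimately obtain c where c: "c \<in> carrier R" "c \<notin> P" "b \<otimes> c = \<zero>"
      using minimal_prime_killed by blast
    then have disj: "basic_open b \<inter> basic_open c = {}"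
      using basic_open_mult[of b c] b basic_open_empty_iff[of \<zero>] by simp
    have "P \<in> Y \<inter> basic_open c" using P c mp unfolding basic_open_def by blast
    then obtain a where "a \<in> carrier R" "a \<notin> P" "basic_open a \<subseteq> Y \<inter> basic_open c"
      using min_open_Int_basic_open[OF Y c(1)] unfolding min_open_def by blast
    then show ?thesis using mp disj by blast
  qed
  then show ?thesis unfolding min_open_def by blast
qed

text \<open>Two points of \<open>Y\<close> are separated by a set \<open>basic_open b\<close> that
  is both open and closed. It cuts \<open>Y\<close> into two nonempty open pieces, at least one of
  them infinite; that piece is \<open>Z\<close>, and \<open>basic_open x\<close> is found in the
  other.\<close>

lemma infinite_min_open_split:
  assumes Y: "min_open Y" and inf: "infinite Y"
  obtains Z x where "min_open Z" "infinite Z" "Z \<subseteq> Y"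
    "x \<in> carrier R" "x \<noteq> \<zero>" "basic_open x \<subseteq> Y - Z"
proof -
  obtain P where P: "P \<in> Y" using inf by fastforce
  obtain Q where Q: "Q \<in> Y" "Q \<noteq> P" using infinite_imp_nonempty[OF infinite_remove[OF inf, of P]] by blast
  have mp: "minimal_prime_ideal R P" "minimal_prime_ideal R Q"
    using P Q Y unfolding min_open_def by blast+
  interpret P: primeideal P R using mp unfolding minimal_prime_ideal_def by blast
  have "\<not> P \<subseteq> Q" using mp Q(2) unfolding minimal_prime_ideal_def by blast
  then obtain b where b: "b \<in> P" "b \<notin> Q" by blast
  have bc: "b \<in> carrier R" using b P.a_subset by blast
  have ne: "P \<in> Y - basic_open b" "Q \<in> Y \<inter> basic_open b"
    using P Q b mp unfolding basic_open_def by blast+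
  have op: "min_open (Y - basic_open b)" "min_open (Y \<inter> basic_open b)"
    using Y bc min_open_Diff_basic_open min_open_Int_basic_open by blast+
  \<comment> \<open>\<open>Z\<close> is an infinite piece and \<open>Z'\<close> the other one. The
    point \<open>W\<close>, which is \<open>Q\<close> or \<open>P\<close> according to the case,
    witnesses that \<open>Z'\<close> is nonempty.\<close>
  obtain Z Z' W where Z: "min_open Z" "infinite Z" "Z \<subseteq> Y" "min_open Z'" "W \<in> Z'" "Z' \<subseteq> Y - Z"
  proof (cases "infinite (Y - basic_open b)")
    case True
    show thesis
      by (rule that[OF op(1) True _ op(2) ne(2)]) blast+
  next
    case False
    then have "infinite (Y \<inter> basic_open b)"
      using Diff_infinite_finite[OF _ inf, of "Y - basic_open b"] by (auto simp: Diff_Diff_Int)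
    then show thesis
      by (rule that[OF op(2) _ _ op(1) ne(1)]) blast+
  qed
  have "minimal_prime_ideal R W \<and> (\<exists>x\<in>carrier R. x \<notin> W \<and> basic_open x \<subseteq> Z')"
    using Z(4,5) unfolding min_open_def by (rule bspec)
  then obtain x where x: "x \<in> carrier R" "basic_open x \<subseteq> Z'" and W: "W \<in> basic_open x"
    unfolding basic_open_def by blast
  have "x \<noteq> \<zero>" using W basic_open_empty_iff[OF x(1)] by blast
  moreover have "basic_open x \<subseteq> Y - Z" using x(2) Z(6) by (rule subset_trans)
  ultimately show thesis using that[OF Z(1-3) x(1)] by blast
qed

section \<open>Orthogonal elements from infinitely many minimal primes\<close>

text \<open>The splitting is iterated: each step keeps an infinite open set and takes an element
  whose basic open set lies in the discarded part. Later choices are made inside the kept set, so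
  the basic open sets are pairwise disjoint.\<close>

lemma infinite_orthogonal_sequence:
  assumes "infinite {P. minimal_prime_ideal R P}"
  obtains x :: "nat \<Rightarrow> 'a" where "\<And>n. x n \<in> carrier R" "\<And>n. x n \<noteq> \<zero>"
    "\<And>m n. m \<noteq> n \<Longrightarrow> x m \<otimes> x n = \<zero>"
proof -
  \<comment> \<open>A state pairs the kept infinite open set with the element just chosen. The
    disjointness clause makes that element orthogonal to all later ones.\<close>
  define Good where "Good p \<longleftrightarrow> min_open (fst p) \<and> infinite (fst p) \<and> snd p \<in> carrier R \<and>
      snd p \<noteq> \<zero> \<and> basic_open (snd p) \<inter> fst p = {}" for p :: "'a set set \<times> 'a"
  define Next where "Next p q \<longleftrightarrow> fst q \<subseteq> fst p \<and> basic_open (snd q) \<subseteq> fst p"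
    for p q :: "'a set set \<times> 'a"
  have step: "\<exists>q. Good q \<and> fst q \<subseteq> Y \<and> basic_open (snd q) \<subseteq> Y"
    if "min_open Y" "infinite Y" for Y
  proof -
    obtain Z x where "min_open Z" "infinite Z" "Z \<subseteq> Y"
      "x \<in> carrier R" "x \<noteq> \<zero>" "basic_open x \<subseteq> Y - Z"
      using infinite_min_open_split[OF \<open>min_open Y\<close> \<open>infinite Y\<close>] .
    then show ?thesis unfolding Good_def by (intro exI[of _ "(Z, x)"]) auto
  qed
  have top: "min_open {P. minimal_prime_ideal R P}"
    unfolding min_open_def
  proof (intro ballI conjI)
    fix P assume "P \<in> {P. minimal_prime_ideal R P}"
    then show mp: "minimal_prime_ideal R P" by simp
    interpret P: primeideal P R using mp unfolding minimal_prime_ideal_def by blast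
    have "\<one> \<notin> P" using P.one_imp_carrier P.I_notcarr by blast
    then show "\<exists>a\<in>carrier R. a \<notin> P \<and> basic_open a \<subseteq> {P. minimal_prime_ideal R P}"
      unfolding basic_open_def by blast
  qed
  have "\<exists>f. \<forall>n::nat. Good (f n) \<and> Next (f n) (f (Suc n))"
  proof (rule dependent_nat_choice)
    show "\<exists>p. Good p" using step[OF top assms] by blast
    show "\<exists>q. Good q \<and> Next p q" if "Good p" for p n
      using step[of "fst p"] that unfolding Good_def Next_def by blast
  qed
  then obtain f where f: "\<And>n::nat. Good (f n)" "\<And>n. Next (f n) (f (Suc n))" by blast
  have anti: "fst (f n) \<subseteq> fst (f m)" if "m \<le> n" for m n
    using that f(2) by (induction rule: dec_induct) (auto simp: Next_def)
  define x where "x n = snd (f n)" for n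
  have x: "x n \<in> carrier R" "x n \<noteq> \<zero>" for n
    using f(1)[of n] unfolding Good_def x_def by blast+
  have less: "x m \<otimes> x n = \<zero>" if mn: "m < n" for m n
  proof -
    \<comment> \<open>\<open>x (Suc k)\<close> is chosen inside the set kept at stage
      \<open>k\<close>, so \<open>n\<close> is written as a successor and that set is compared with
      the one kept at stage \<open>m \<le> k\<close>.\<close>
    obtain k where k: "n = Suc k" "m \<le> k" using less_imp_Suc_add[OF mn] le_add1 by blast
    have "basic_open (x n) \<subseteq> fst (f m)"
      using f(2)[of k] anti[OF k(2)] unfolding Next_def x_def k(1) by blast
    moreover have "basic_open (x m) \<inter> fst (f m) = {}"
      using f(1)[of m] unfolding Good_def x_def by blast
    ultimately have "basic_open (x m \<otimes> x n) = {}"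
      using x by (simp add: basic_open_mult) blast
    then show ?thesis using x by (simp add: basic_open_empty_iff)
  qed
  then have "x m \<otimes> x n = \<zero>" if "m \<noteq> n" for m n
    using that x by (metis m_comm nat_neq_iff)
  then show thesis using that x by blast
qed

end

section \<open>The annihilating graph of a faithful module with zero radical\<close>

lemma (in Module.module) faithful_smult_zero:
  assumes "faithful_module R M" "r \<in> carrier R"
    and "\<And>x. x \<in> carrier M \<Longrightarrow> r \<odot>\<^bsub>M\<^esub> x = \<zero>\<^bsub>M\<^esub>"
  shows "r = \<zero>"
  using assms unfolding faithful_module_def annihilator_def residual_def by blast

text \<open>If \<open>r\<close> has square zero, it kills \<open>r x\<close>. A prime submodule
  \<open>P\<close> then contains \<open>r x\<close> in either case: because \<open>r\<close> carries
  all of \<open>M\<close> into \<open>P\<close>, or directly. So \<open>r M\<close> lies in the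
  radical, which is zero, and faithfulness gives \<open>r = \<zero>\<close>.\<close>

lemma (in Module.module) reduced_of_prime_radical_zero:
  assumes faithful: "faithful_module R M"
    and rad: "prime_radical R M {\<zero>\<^bsub>M\<^esub>} = {\<zero>\<^bsub>M\<^esub>}"
  shows "reduced_cring R"
proof
  fix r assume r: "r \<in> carrier R" "r \<otimes> r = \<zero>"
  have "r \<odot>\<^bsub>M\<^esub> x = \<zero>\<^bsub>M\<^esub>" if x: "x \<in> carrier M" for x
  proof -
    have "r \<odot>\<^bsub>M\<^esub> (r \<odot>\<^bsub>M\<^esub> x) = \<zero>\<^bsub>M\<^esub>"
      using r x smult_assoc1[of r r x] by simp
    then have "r \<in> residual R M P \<or> r \<odot>\<^bsub>M\<^esub> x \<in> P"
      if "prime_submodule R M P" "{\<zero>\<^bsub>M\<^esub>} \<subseteq> P" for P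
      using that r x unfolding prime_submodule_def by simp
    then have "r \<odot>\<^bsub>M\<^esub> x \<in> P" if "prime_submodule R M P" "{\<zero>\<^bsub>M\<^esub>} \<subseteq> P" for P
      using that x unfolding residual_def by blast
    \<comment> \<open>If there is no prime submodule at all, \<open>prime_radical\<close> takes the
      default value \<open>carrier M\<close>, which contains \<open>r x\<close> as well.\<close>
    then have "r \<odot>\<^bsub>M\<^esub> x \<in> prime_radical R M {\<zero>\<^bsub>M\<^esub>}"
      unfolding prime_radical_def using r x by auto
    then show ?thesis using rad by simp
  qed
  then show "r = \<zero>" using faithful_smult_zero[OF faithful r(1)] by blast
qed

lemma (in Module.module) zero_in_residual:
  assumes "submodule N R M"
  shows "\<zero> \<in> residual R M N"
proof -
  have "\<zero>\<^bsub>M\<^esub> \<in> N" using subgroup.one_closed[OF submodule.axioms(1)[OF assms]] by simp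
  then show ?thesis unfolding residual_def by simp
qed

text \<open>A product \<open>r \<otimes> s\<close> that kills \<open>M\<close> is zero by
  faithfulness. Adjacency in the graph thus becomes a condition on residual ideals, stated entirely
  inside \<open>R\<close>.\<close>

lemma (in Module.module) submodule_prod_zero_iff:
  assumes faithful: "faithful_module R M" and N: "submodule N R M" and K: "submodule K R M"
  shows "submodule_prod R M N K = {\<zero>\<^bsub>M\<^esub>} \<longleftrightarrow>
    (\<forall>r\<in>residual R M N. \<forall>s\<in>residual R M K. r \<otimes> s = \<zero>)"
proof
  assume prod: "submodule_prod R M N K = {\<zero>\<^bsub>M\<^esub>}"
  show "\<forall>r\<in>residual R M N. \<forall>s\<in>residual R M K. r \<otimes> s = \<zero>"
  proof (intro ballI)
    fix r s assume rs: "r \<in> residual R M N" "s \<in> residual R M K"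
    have "(r \<otimes> s) \<odot>\<^bsub>M\<^esub> x = \<zero>\<^bsub>M\<^esub>" if "x \<in> carrier M" for x
      using prod ideal_smult.smult[OF ideal_prod.prod[OF rs] that]
      unfolding submodule_prod_def by blast
    then show "r \<otimes> s = \<zero>"
      using faithful_smult_zero[OF faithful] rs unfolding residual_def by simp
  qed
next
  assume zero: "\<forall>r\<in>residual R M N. \<forall>s\<in>residual R M K. r \<otimes> s = \<zero>"
  let ?I = "ideal_prod R (residual R M N) (residual R M K)"
  have I: "a = \<zero>" if "a \<in> ?I" for a
    using that by induction (use zero in auto)
  have le: "y = \<zero>\<^bsub>M\<^esub>" if "y \<in> ideal_smult M ?I" for y
    using that by induction (auto dest: I)
  \<comment> \<open>Equality with the zero submodule, and not just inclusion, requires zero as a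
    member of \<open>ideal_smult\<close>; it is produced from a generator.\<close>
  have "\<zero> \<otimes> \<zero> \<in> ?I"
    by (intro ideal_prod.prod zero_in_residual N K)
  then have "\<zero> \<otimes> \<zero> \<odot>\<^bsub>M\<^esub> \<zero>\<^bsub>M\<^esub> \<in> ideal_smult M ?I"
    by (intro ideal_smult.smult) auto
  then have "\<zero>\<^bsub>M\<^esub> \<in> ideal_smult M ?I" by simp
  moreover have "ideal_smult M ?I \<subseteq> {\<zero>\<^bsub>M\<^esub>}"
    by (rule subsetI, drule le, simp)
  ultimately show "submodule_prod R M N K = {\<zero>\<^bsub>M\<^esub>}"
    unfolding submodule_prod_def by (intro subset_antisym) simp_all
qed

section \<open>Colouring by minimal primes\<close>

text \<open>The residual of a vertex is nonzero, so some minimal prime fails to contain it. If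
  adjacent vertices shared such a prime, elements of their residuals outside it would have product
  zero, which lies in the prime.\<close>

lemma (in Module.module) AG_star_colouring:
  assumes faithful: "faithful_module R M" and red: "reduced_cring R"
    and fin: "finite {P. minimal_prime_ideal R P}"
  shows "\<exists>k f. proper_colouring (AG_star R M) k f"
proof -
  interpret reduced_cring R by (rule red)
  let ?Min = "{P. minimal_prime_ideal R P}"
  \<comment> \<open>Colours are natural numbers, so \<open>h\<close> numbers the minimal
    primes.\<close>
  obtain h where h: "bij_betw h ?Min {..<card ?Min}"
    using ex_bij_betw_finite_nat[OF fin] unfolding atLeast0LessThan by blast
  define c where "c N = (SOME P. P \<in> ?Min \<and> \<not> residual R M N \<subseteq> P)" for N
  have c: "c N \<in> ?Min \<and> \<not> residual R M N \<subseteq> c N" if "N \<in> AG_star_verts R M" for N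
  proof -
    have "submodule N R M" "residual R M N \<noteq> {\<zero>}"
      using that faithful
      unfolding AG_star_verts_def proper_submodule_def faithful_module_def by auto
    then obtain r where "r \<in> residual R M N" "r \<noteq> \<zero>"
      using zero_in_residual by blast
    moreover from this have "r \<in> carrier R" unfolding residual_def by blast
    ultimately have "\<exists>P. P \<in> ?Min \<and> \<not> residual R M N \<subseteq> P"
      using minimal_prime_not_containing by blast
    then show ?thesis unfolding c_def by (rule someI_ex)
  qed
  have neq: "c N \<noteq> c K"
    if NK: "N \<in> AG_star_verts R M" "K \<in> AG_star_verts R M"
      and prod: "submodule_prod R M N K = {\<zero>\<^bsub>M\<^esub>}" for N K
  proof
    assume eq: "c N = c K"
    obtain r s where rs: "r \<in> residual R M N" "r \<notin> c N" "s \<in> residual R M K" "s \<notin> c N"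
      using c[OF NK(1)] c[OF NK(2)] eq by blast
    interpret P: primeideal "c N" R
      using c[OF NK(1)] unfolding minimal_prime_ideal_def by blast
    have "r \<otimes> s = \<zero>"
      using submodule_prod_zero_iff[OF faithful, of N K] prod NK rs
      unfolding AG_star_verts_def proper_submodule_def by blast
    then show False
      using P.I_prime[of r s] P.zero_closed rs unfolding residual_def by auto
  qed
  have "proper_colouring (AG_star R M) (card ?Min) (h \<circ> c)"
    unfolding proper_colouring_def
  proof (intro conjI ballI impI)
    show "(h \<circ> c) ` ug_verts (AG_star R M) \<subseteq> {..<card ?Min}"
      using c bij_betw_apply[OF h] by (auto simp: AG_star_def)
    fix N K assume "{N, K} \<in> ug_edges (AG_star R M)"
    then have "c N \<noteq> c K" "N \<in> AG_star_verts R M" "K \<in> AG_star_verts R M"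
      using neq by (auto simp: AG_star_def doubleton_eq_iff)
    then show "(h \<circ> c) N \<noteq> (h \<circ> c) K"
      using c inj_onD[OF bij_betw_imp_inj_on[OF h], of "c N" "c K"] by auto
  qed
  then show ?thesis by blast
qed

section \<open>An infinite complete subgraph from orthogonal elements\<close>

text \<open>For a single scalar the plain image \<open>a M\<close> is already closed under sums, so
  no finite sums need to be formed; closure under scalars uses commutativity of
  \<open>R\<close>.\<close>

lemma (in Module.module) submodule_smult_image:
  assumes a: "a \<in> carrier R"
  shows "submodule ((\<lambda>m. a \<odot>\<^bsub>M\<^esub> m) ` carrier M) R M"
proof (rule submoduleI)
  let ?N = "(\<lambda>m. a \<odot>\<^bsub>M\<^esub> m) ` carrier M"
  show "?N \<subseteq> carrier M" using a by auto
  show "\<zero>\<^bsub>M\<^esub> \<in> ?N" using a by (intro image_eqI[of _ _ "\<zero>\<^bsub>M\<^esub>"]) auto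
  show "\<ominus>\<^bsub>M\<^esub> x \<in> ?N" if x: "x \<in> ?N" for x
  proof -
    obtain m where m: "m \<in> carrier M" "x = a \<odot>\<^bsub>M\<^esub> m" using x by blast
    then have "\<ominus>\<^bsub>M\<^esub> x = a \<odot>\<^bsub>M\<^esub> (\<ominus>\<^bsub>M\<^esub> m)" using a by (simp add: smult_r_minus)
    then show ?thesis using m by blast
  qed
  show "x \<oplus>\<^bsub>M\<^esub> y \<in> ?N" if xy: "x \<in> ?N" "y \<in> ?N" for x y
  proof -
    obtain m n where mn: "m \<in> carrier M" "x = a \<odot>\<^bsub>M\<^esub> m" "n \<in> carrier M" "y = a \<odot>\<^bsub>M\<^esub> n"
      using xy by blast
    then have "x \<oplus>\<^bsub>M\<^esub> y = a \<odot>\<^bsub>M\<^esub> (m \<oplus>\<^bsub>M\<^esub> n)" using a by (simp add: smult_r_distr)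
    then show ?thesis using mn by blast
  qed
  show "b \<odot>\<^bsub>M\<^esub> x \<in> ?N" if b: "b \<in> carrier R" and x: "x \<in> ?N" for b x
  proof -
    obtain m where m: "m \<in> carrier M" "x = a \<odot>\<^bsub>M\<^esub> m" using x by blast
    then have "b \<odot>\<^bsub>M\<^esub> x = a \<odot>\<^bsub>M\<^esub> (b \<odot>\<^bsub>M\<^esub> m)"
      using a b smult_assoc1[of a b m] smult_assoc1[of b a m] by (simp add: m_comm)
    then show ?thesis using m b by blast
  qed
qed

text \<open>An infinite orthogonal sequence \<open>x\<close> gives the vertices \<open>N n\<close>,
  the submodules \<open>x n M\<close>. Orthogonality makes them adjacent, and reducedness makes them
  distinct.\<close>

lemma (in Module.module) infinite_complete_subgraph_AG_star:
  assumes faithful: "faithful_module R M" and red: "reduced_cring R"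
    and inf: "infinite {P. minimal_prime_ideal R P}"
  shows "\<exists>C. complete_subgraph (AG_star R M) C \<and> infinite C"
proof -
  interpret reduced_cring R by (rule red)
  obtain x :: "nat \<Rightarrow> 'a" where x: "\<And>n. x n \<in> carrier R" "\<And>n. x n \<noteq> \<zero>"
    and orth: "\<And>m n. m \<noteq> n \<Longrightarrow> x m \<otimes> x n = \<zero>"
    using infinite_orthogonal_sequence[OF inf] by blast
  define N where "N n = (\<lambda>m. x n \<odot>\<^bsub>M\<^esub> m) ` carrier M" for n
  have sub: "submodule (N n) R M" for n
    unfolding N_def using x(1) by (rule submodule_smult_image)
  have x_mem: "x n \<in> residual R M (N n)" for n
    unfolding residual_def N_def using x by blast
  have smult_N: "x m \<odot>\<^bsub>M\<^esub> y = \<zero>\<^bsub>M\<^esub>" if "m \<noteq> n" "y \<in> N n" for m n y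
    using that x orth[of m n] smult_assoc1[of "x m" "x n", symmetric] unfolding N_def by auto
  have prod: "submodule_prod R M (N m) (N n) = {\<zero>\<^bsub>M\<^esub>}" if mn: "m \<noteq> n" for m n
    unfolding submodule_prod_zero_iff[OF faithful sub sub]
  proof (intro ballI)
    \<comment> \<open>The residual of \<open>N n\<close> may be larger than the ideal generated by
      \<open>x n\<close>, so arbitrary \<open>r\<close> and \<open>s\<close> are treated. Here
      \<open>s y\<close> has the form \<open>x n z\<close>, and \<open>r z\<close> lies in
      \<open>N m\<close>, which \<open>x n\<close> kills.\<close>
    fix r s assume r: "r \<in> residual R M (N m)" and s: "s \<in> residual R M (N n)"
    then have rs: "r \<in> carrier R" "s \<in> carrier R" unfolding residual_def by blast+
    have "(r \<otimes> s) \<odot>\<^bsub>M\<^esub> y = \<zero>\<^bsub>M\<^esub>" if y: "y \<in> carrier M" for y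
    proof -
      obtain z where z: "z \<in> carrier M" "s \<odot>\<^bsub>M\<^esub> y = x n \<odot>\<^bsub>M\<^esub> z"
        using s y unfolding residual_def N_def by blast
      have "r \<odot>\<^bsub>M\<^esub> z \<in> N m" using r z unfolding residual_def by blast
      then have "x n \<odot>\<^bsub>M\<^esub> (r \<odot>\<^bsub>M\<^esub> z) = \<zero>\<^bsub>M\<^esub>" using smult_N[of n m] mn by blast
      moreover have "(r \<otimes> s) \<odot>\<^bsub>M\<^esub> y = (r \<otimes> x n) \<odot>\<^bsub>M\<^esub> z"
        using rs x(1) y z by (simp add: smult_assoc1)
      moreover have "(r \<otimes> x n) \<odot>\<^bsub>M\<^esub> z = x n \<odot>\<^bsub>M\<^esub> (r \<odot>\<^bsub>M\<^esub> z)"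
        using rs(1) x(1) z(1) by (simp add: m_comm[of r] smult_assoc1)
      ultimately show ?thesis by simp
    qed
    then show "r \<otimes> s = \<zero>" using faithful_smult_zero[OF faithful] rs by simp
  qed
  have proper: "proper_submodule R M (N n)" for n
  proof -
    \<comment> \<open>The nonzero element \<open>x (Suc n)\<close> kills \<open>N n\<close>; if
      \<open>N n\<close> were all of \<open>M\<close>, this would contradict faithfulness.\<close>
    have False if "N n = carrier M"
      using smult_N[of "Suc n" n] that x(2)[of "Suc n"]
        faithful_smult_zero[OF faithful x(1)[of "Suc n"]] by simp
    then show ?thesis unfolding proper_submodule_def using sub by blast
  qed
  have nz: "residual R M (N n) \<noteq> annihilator R M" for n
    using x_mem[of n] x(2)[of n] faithful unfolding faithful_module_def by auto
  have vert: "N n \<in> AG_star_verts R M" for n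
  proof -
    \<comment> \<open>The next member of the sequence is the annihilating partner that a vertex must
      have.\<close>
    have "submodule_prod R M (N n) (N (Suc n)) = {\<zero>\<^bsub>M\<^esub>}" by (rule prod) simp
    then show ?thesis unfolding AG_star_verts_def using proper nz by blast
  qed
  have "inj N"
  proof (rule injI, rule ccontr)
    fix m n assume eq: "N m = N n" and "m \<noteq> n"
    \<comment> \<open>If \<open>N m = N n\<close>, then \<open>x m\<close> kills its own image
      \<open>x m M\<close>, so its square kills \<open>M\<close> and is zero.\<close>
    have "(x m \<otimes> x m) \<odot>\<^bsub>M\<^esub> y = \<zero>\<^bsub>M\<^esub>" if y: "y \<in> carrier M" for y
    proof -
      have "x m \<odot>\<^bsub>M\<^esub> y \<in> N m" using y unfolding N_def by (rule imageI)
      then have "x m \<odot>\<^bsub>M\<^esub> y \<in> N n" unfolding eq .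
      then show ?thesis using smult_N[OF \<open>m \<noteq> n\<close>] x y by (simp add: smult_assoc1)
    qed
    then have "x m \<otimes> x m = \<zero>" using faithful_smult_zero[OF faithful] x by simp
    then show False using reduced x by blast
  qed
  then have "infinite (range N)" by (rule range_inj_infinite)
  moreover have "complete_subgraph (AG_star R M) (range N)"
    unfolding complete_subgraph_def
  proof (intro conjI ballI impI)
    show "range N \<subseteq> ug_verts (AG_star R M)" using vert by (auto simp: AG_star_def)
    fix u v assume "u \<in> range N" "v \<in> range N" and ne: "u \<noteq> v"
    then obtain m n where mn: "u = N m" "v = N n" by blast
    then have "submodule_prod R M u v = {\<zero>\<^bsub>M\<^esub>}" using ne prod[of m n] by blast
    moreover have "u \<in> AG_star_verts R M" "v \<in> AG_star_verts R M" using vert mn by simp_all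
    ultimately show "{u, v} \<in> ug_edges (AG_star R M)"
      using ne unfolding AG_star_def ugraph.simps by blast
  qed
  ultimately show ?thesis by blast
qed

theorem proposition3p11:
  fixes R :: "('a, 'c) ring_scheme" and M :: "('a, 'b, 'd) module_scheme"
  assumes "Module.module R M"
    and "\<one>\<^bsub>R\<^esub> \<noteq> \<zero>\<^bsub>R\<^esub>"
    and "faithful_module R M"
    and "prime_radical R M {\<zero>\<^bsub>M\<^esub>} = {\<zero>\<^bsub>M\<^esub>}"
  shows "(chromatic_number (AG_star R M) \<noteq> \<infinity> \<longleftrightarrow> clique_number (AG_star R M) \<noteq> \<infinity>) \<and>
         (clique_number (AG_star R M) \<noteq> \<infinity> \<longleftrightarrow> \<not> (\<exists>C. clique (AG_star R M) C \<and> infinite C)) \<and>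
         (\<not> (\<exists>C. clique (AG_star R M) C \<and> infinite C) \<longleftrightarrow> finite {P. minimal_prime_ideal R P})"
proof -
  interpret Module.module R M by fact
  let ?G = "AG_star R M"
  have red: "reduced_cring R"
    using assms(3,4) by (rule reduced_of_prime_radical_zero)
  \<comment> \<open>The equivalences follow from a cycle of four implications: colouring, clique
    number, no infinite clique, finitely many minimal primes, and back to colouring.\<close>
  have "clique_number ?G \<noteq> \<infinity>" if "chromatic_number ?G \<noteq> \<infinity>"
    using that clique_number_finite unfolding chromatic_number_finite_iff by blast
  moreover have "\<not> (\<exists>C. clique ?G C \<and> infinite C)" if "clique_number ?G \<noteq> \<infinity>"
    using that by (auto dest: clique_number_infinite)
  moreover have "finite {P. minimal_prime_ideal R P}" if "\<not> (\<exists>C. clique ?G C \<and> infinite C)"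
    using that infinite_complete_subgraph_AG_star[OF assms(3) red]
    by (meson complete_subgraph_extends_to_clique infinite_super)
  moreover have "chromatic_number ?G \<noteq> \<infinity>" if "finite {P. minimal_prime_ideal R P}"
    using AG_star_colouring[OF assms(3) red that] unfolding chromatic_number_finite_iff .
  ultimately show ?thesis by blast
qed

end
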